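(* Let $(X^{(n)})_{n\ge 1}$ be a sequence of reversible and irreducible continuous time Markov chains with state spaces $S^{(n)}$. A sequence $(f_n)_{n\ge1}$ of Boolean functions, $f_n\colon S^{(n)}\to\{0,1\}$, is noise stable with respect to $(X^{(n)})_{n\ge1}$ if and only if for all $\delta>0$ there is $k\in\mathbb N$ such that $$\sup_{n}\ \sum_{i\colon \lambda_i^{(n)}\ge k\lambda_1^{(n)}}\hat f_n(i)^2<\delta.$$
   Context: Each $X^{(n)}=(X^{(n)}_t)_{t\ge0}$ has a finite state space $S^{(n)}$ with $|S^{(n)}|\ge2$, generator $Q_n=(q^{(n)}_{ij})_{i,j\in S^{(n)}}$ and stationary distribution $\pi_n$; $X_0^{(n)}$ is always distributed according to $\pi_n$. For $f,g\colon S^{(n)}\to\mathbb R$, $\langle f,g\rangle=\sum_{w\in S^{(n)}}\pi_n(w)f(w)g(w)$. Let $0=\lambda_0^{(n)}<\lambda_1^{(n)}\le\lambda_2^{(n)}\le\dots\le\lambda^{(n)}_{|S^{(n)}|-1}$ be the eigenvalues of $-Q_n$, with corresponding eigenvectors $\psi_0^{(n)}\equiv 1,\psi_1^{(n)},\dots,\psi^{(n)}_{|S^{(n)}|-1}$ forming an orthonormal basis of the real functions on $S^{(n)}$ with respect to $\langle\cdot,\cdot\rangle$. For $f\colon S^{(n)}\to\mathbb R$ write $\hat f(i)=\langle f,\psi_i^{(n)}\rangle$. The relaxation time is $t_{rel}^{(n)}=1/\lambda_1^{(n)}$. Noise stability: $(f_n)_{n\ge1}$ with $f_n\colon S^{(n)}\to\{0,1\}$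 is noise stable with respect to $(X^{(n)})_{n\ge1}$ if $\lim_{\alpha\to0^+}\sup_n P\bigl(f_n(X_0^{(n)})\ne f_n(X^{(n)}_{\alpha t_{rel}^{(n)}})\bigr)=0$. *)

theory Defs
  imports "HOL-Probability.Probability"
begin

section \<open>Generators on a finite state space\<close>

text \<open>
  A chain lives on a finite set S of an arbitrary type, so that the chains of a sequence may have
  different state spaces.  Rates, distributions and functions are total HOL functions of which only
  the values on S are ever used.
\<close>

definition generator_on :: "'s set \<Rightarrow> ('s \<Rightarrow> 's \<Rightarrow> real) \<Rightarrow> bool" where
  "generator_on S Q \<longleftrightarrow>
     (\<forall>x\<in>S. \<forall>y\<in>S. x \<noteq> y \<longrightarrow> 0 \<le> Q x y) \<and> (\<forall>x\<in>S. (\<Sum>y\<in>S. Q x y) = 0)"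

fun matrix_power_on :: "'s set \<Rightarrow> ('s \<Rightarrow> 's \<Rightarrow> real) \<Rightarrow> nat \<Rightarrow> 's \<Rightarrow> 's \<Rightarrow> real" where
  "matrix_power_on S Q 0 x y = (if x = y then 1 else 0)"
| "matrix_power_on S Q (Suc k) x y = (\<Sum>z\<in>S. Q x z * matrix_power_on S Q k z y)"

text \<open>
  The transition function generated by Q, that is, the (x, y) entry of the matrix exponential
  exp (t Q); the series converges absolutely for all x, y in the finite set S.
\<close>

definition transition_function :: "'s set \<Rightarrow> ('s \<Rightarrow> 's \<Rightarrow> real) \<Rightarrow> real \<Rightarrow> 's \<Rightarrow> 's \<Rightarrow> real" where
  "transition_function S Q t x y = (\<Sum>k. t ^ k / fact k * matrix_power_on S Q k x y)"

definition irreducible_on :: "'s set \<Rightarrow> ('s \<Rightarrow> 's \<Rightarrow> real) \<Rightarrow> bool" where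
  "irreducible_on S Q \<longleftrightarrow>
     (\<forall>x\<in>S. \<forall>y\<in>S. (x, y) \<in> {(u, v). u \<in> S \<and> v \<in> S \<and> u \<noteq> v \<and> 0 < Q u v}\<^sup>*)"

definition stationary_distribution :: "'s set \<Rightarrow> ('s \<Rightarrow> 's \<Rightarrow> real) \<Rightarrow> ('s \<Rightarrow> real) \<Rightarrow> bool" where
  "stationary_distribution S Q \<pi> \<longleftrightarrow>
     (\<forall>x\<in>S. 0 \<le> \<pi> x) \<and> (\<Sum>x\<in>S. \<pi> x) = 1 \<and> (\<forall>y\<in>S. (\<Sum>x\<in>S. \<pi> x * Q x y) = 0)"

definition reversible_on :: "'s set \<Rightarrow> ('s \<Rightarrow> 's \<Rightarrow> real) \<Rightarrow> ('s \<Rightarrow> real) \<Rightarrow> bool" where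
  "reversible_on S Q \<pi> \<longleftrightarrow> (\<forall>x\<in>S. \<forall>y\<in>S. \<pi> x * Q x y = \<pi> y * Q y x)"


section \<open>Continuous time Markov chains\<close>

text \<open>
  A process (X t), t at least 0, on a probability space M that is a Markov chain on the finite set S
  with generator Q and initial distribution \<open>\<mu>\<close>.  The values of X at negative times are irrelevant.
\<close>

locale finite_ctmc = prob_space M
  for M :: "'w measure"
    and X :: "real \<Rightarrow> 'w \<Rightarrow> 's"
    and S :: "'s set"
    and Q :: "'s \<Rightarrow> 's \<Rightarrow> real"
    and \<mu> :: "'s \<Rightarrow> real" +
  assumes finite_states: "finite S"
    and generator: "generator_on S Q"
    and measurable_X: "\<And>t. 0 \<le> t \<Longrightarrow> X t \<in> measurable M (count_space S)"
    and initial: "\<And>x. x \<in> S \<Longrightarrow> \<P>(\<omega> in M. X 0 \<omega> = x) = \<mu> x"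
    and markov: "\<And>(t :: nat \<Rightarrow> real) (x :: nat \<Rightarrow> 's) m.
      0 \<le> t 0 \<Longrightarrow> (\<And>j. j \<le> m \<Longrightarrow> t j < t (Suc j)) \<Longrightarrow> (\<And>j. j \<le> Suc m \<Longrightarrow> x j \<in> S) \<Longrightarrow>
      0 < \<P>(\<omega> in M. \<forall>j\<le>m. X (t j) \<omega> = x j) \<Longrightarrow>
      \<P>(\<omega> in M. X (t (Suc m)) \<omega> = x (Suc m) \<bar> \<forall>j\<le>m. X (t j) \<omega> = x j)
        = transition_function S Q (t (Suc m) - t m) (x m) (x (Suc m))"


section \<open>Spectral decomposition\<close>

definition stat_inner :: "'s set \<Rightarrow> ('s \<Rightarrow> real) \<Rightarrow> ('s \<Rightarrow> real) \<Rightarrow> ('s \<Rightarrow> real) \<Rightarrow> real" where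
  "stat_inner S \<pi> f g = (\<Sum>w\<in>S. \<pi> w * f w * g w)"

text \<open>
  The eigenvalues of -Q, listed with multiplicity as lam 0, ..., lam (|S| - 1), together with a
  corresponding orthonormal basis of eigenvectors \<open>\<psi>\<close> 0, ..., \<open>\<psi>\<close> (|S| - 1).
\<close>

definition spectral_decomposition ::
    "'s set \<Rightarrow> ('s \<Rightarrow> 's \<Rightarrow> real) \<Rightarrow> ('s \<Rightarrow> real) \<Rightarrow> (nat \<Rightarrow> real) \<Rightarrow> (nat \<Rightarrow> 's \<Rightarrow> real) \<Rightarrow> bool" where
  "spectral_decomposition S Q \<pi> lam \<psi> \<longleftrightarrow>
     lam 0 = 0 \<and> 0 < lam 1 \<and> (\<forall>i j. i \<le> j \<and> j < card S \<longrightarrow> lam i \<le> lam j) \<and>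
     (\<forall>x\<in>S. \<psi> 0 x = 1) \<and>
     (\<forall>i<card S. \<forall>x\<in>S. - (\<Sum>y\<in>S. Q x y * \<psi> i y) = lam i * \<psi> i x) \<and>
     (\<forall>i<card S. \<forall>j<card S. stat_inner S \<pi> (\<psi> i) (\<psi> j) = (if i = j then 1 else 0)) \<and>
     (\<forall>g. \<exists>c. \<forall>x\<in>S. g x = (\<Sum>i<card S. c i * \<psi> i x))"

definition fourier_coeff ::
    "'s set \<Rightarrow> ('s \<Rightarrow> real) \<Rightarrow> (nat \<Rightarrow> 's \<Rightarrow> real) \<Rightarrow> ('s \<Rightarrow> real) \<Rightarrow> nat \<Rightarrow> real" where
  "fourier_coeff S \<pi> \<psi> f i = stat_inner S \<pi> f (\<psi> i)"

definition relaxation_time :: "(nat \<Rightarrow> real) \<Rightarrow> real" where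
  "relaxation_time lam = 1 / lam 1"


section \<open>Noise stability\<close>

text \<open>
  Sequences are indexed by n at least 1.  The suprema are over nonempty sets of probabilities, hence
  bounded, so the supremum on the conditionally complete type real is the true one.
\<close>

definition noise_stable ::
    "(nat \<Rightarrow> 'w measure) \<Rightarrow> (nat \<Rightarrow> real \<Rightarrow> 'w \<Rightarrow> 's) \<Rightarrow> (nat \<Rightarrow> real) \<Rightarrow> (nat \<Rightarrow> 's \<Rightarrow> real) \<Rightarrow> bool" where
  "noise_stable M X t_rel f \<longleftrightarrow>
     ((\<lambda>\<alpha>. SUP n\<in>{1..}. \<P>(\<omega> in M n. f n (X n 0 \<omega>) \<noteq> f n (X n (\<alpha> * t_rel n) \<omega>)))
        \<longlongrightarrow> 0) (at_right 0)"

end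

theory Submission
  imports Defs
begin

text \<open>
  Everything rests on one exact formula.  For a Boolean function \<open>f\<close> the indicator of the event
  that \<open>f\<close> changes its value between two states is \<open>(f x - f y)\<^sup>2\<close>.  Expanding the square and
  diagonalising the transition operator, whose eigenvalues are \<open>exp (- \<lambda>\<^sub>i t)\<close>, gives
  \<open>P (f (X\<^sub>0) \<noteq> f (X\<^sub>t)) = 2 \<Sum>\<^sub>i (1 - exp (- \<lambda>\<^sub>i t)) (\<langle>f, \<psi>\<^sub>i\<rangle>)\<^sup>2\<close>
  (lemma \<open>disagreement_spectral\<close>).  At time \<open>t = \<alpha> / \<lambda>\<^sub>1\<close> the weight \<open>1 - exp (- \<alpha> \<lambda>\<^sub>i / \<lambda>\<^sub>1)\<close> is at
  least a half once \<open>\<lambda>\<^sub>i \<ge> k \<lambda>\<^sub>1\<close> and \<open>\<alpha> k \<ge> 1\<close>, and it is at most \<open>\<alpha> k\<close> when \<open>\<lambda>\<^sub>i < k \<lambda>\<^sub>1\<close>.  Hence the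
  probability of disagreement dominates the spectral mass above level \<open>k\<close> as soon as \<open>\<alpha> k \<ge> 1\<close>, and
  exceeds twice that mass by at most \<open>2 \<alpha> k\<close>, the total mass of a Boolean function being at most 1.
  These two bounds (\<open>tail_le_disagreement\<close> and \<open>disagreement_le_tail\<close>) do not depend on the chain, so
  they survive taking the supremum over \<open>n\<close>, and each yields one direction of the equivalence.
\<close>

section \<open>The transition operator on eigenvectors\<close>

text \<open>
  The sum of all absolute entries bounds the operator norm of the matrix; the resulting geometric
  bound makes the exponential series converge entrywise.
\<close>

lemma abs_matrix_power_on_le:
  assumes "finite S" "x \<in> S"
  shows "\<bar>matrix_power_on S Q k x y\<bar> \<le> (\<Sum>u\<in>S. \<Sum>v\<in>S. \<bar>Q u v\<bar>) ^ k"
  using assms(2)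
proof (induction k arbitrary: x)
  case 0
  then show ?case by simp
next
  case (Suc k)
  let ?C = "\<Sum>u\<in>S. \<Sum>v\<in>S. \<bar>Q u v\<bar>"
  have C: "0 \<le> ?C" by (intro sum_nonneg) auto
  have "\<bar>matrix_power_on S Q (Suc k) x y\<bar> \<le> (\<Sum>z\<in>S. \<bar>Q x z\<bar> * \<bar>matrix_power_on S Q k z y\<bar>)"
    by (simp flip: abs_mult)
  also have "\<dots> \<le> (\<Sum>z\<in>S. \<bar>Q x z\<bar> * ?C ^ k)"
    using Suc.IH by (intro sum_mono mult_left_mono) auto
  also have "\<dots> = (\<Sum>z\<in>S. \<bar>Q x z\<bar>) * ?C ^ k"
    by (simp add: sum_distrib_right)
  also have "\<dots> \<le> ?C * ?C ^ k"
  proof (intro mult_right_mono)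
    show "(\<Sum>z\<in>S. \<bar>Q x z\<bar>) \<le> ?C"
      using member_le_sum[of x S "\<lambda>u. \<Sum>v\<in>S. \<bar>Q u v\<bar>"] assms(1) Suc.prems
      by (simp add: sum_nonneg)
  qed (use C in simp)
  finally show ?case by simp
qed

lemma summable_transition_function:
  assumes "finite S" "x \<in> S"
  shows "summable (\<lambda>k. t ^ k / fact k * matrix_power_on S Q k x y)"
proof (rule summable_comparison_test')
  let ?C = "\<Sum>u\<in>S. \<Sum>v\<in>S. \<bar>Q u v\<bar>"
  show "summable (\<lambda>k. inverse (fact k) * (\<bar>t\<bar> * ?C) ^ k)"
    by (rule summable_exp)
  fix k :: nat
  have "norm (t ^ k / fact k * matrix_power_on S Q k x y)
      = \<bar>t\<bar> ^ k / fact k * \<bar>matrix_power_on S Q k x y\<bar>"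
    by (simp add: abs_mult power_abs)
  also have "\<dots> \<le> \<bar>t\<bar> ^ k / fact k * ?C ^ k"
    using abs_matrix_power_on_le[OF assms] by (intro mult_left_mono) auto
  finally show "norm (t ^ k / fact k * matrix_power_on S Q k x y)
      \<le> inverse (fact k) * (\<bar>t\<bar> * ?C) ^ k"
    by (simp add: power_mult_distrib field_simps)
qed

lemma matrix_power_on_eigenvector:
  assumes "finite S" "\<And>x. x \<in> S \<Longrightarrow> (\<Sum>y\<in>S. Q x y * \<phi> y) = c * \<phi> x" "x \<in> S"
  shows "(\<Sum>y\<in>S. matrix_power_on S Q k x y * \<phi> y) = c ^ k * \<phi> x"
  using assms(3)
proof (induction k arbitrary: x)
  case 0
  have "(\<Sum>y\<in>S. matrix_power_on S Q 0 x y * \<phi> y) = (\<Sum>y\<in>S. if x = y then \<phi> y else 0)"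
    by (intro sum.cong) auto
  then show ?case using 0 assms(1) by simp
next
  case (Suc k)
  have "(\<Sum>y\<in>S. matrix_power_on S Q (Suc k) x y * \<phi> y)
      = (\<Sum>y\<in>S. \<Sum>z\<in>S. Q x z * (matrix_power_on S Q k z y * \<phi> y))"
    by (simp add: sum_distrib_right mult.assoc)
  also have "\<dots> = (\<Sum>z\<in>S. Q x z * (\<Sum>y\<in>S. matrix_power_on S Q k z y * \<phi> y))"
    by (subst sum.swap) (simp add: sum_distrib_left)
  also have "\<dots> = (\<Sum>z\<in>S. c ^ k * (Q x z * \<phi> z))"
    using Suc.IH by (intro sum.cong) auto
  also have "\<dots> = c ^ Suc k * \<phi> x"
    using assms(2)[OF Suc.prems] by (simp flip: sum_distrib_left)
  finally show ?case .
qed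

lemma transition_function_eigenvector:
  assumes "finite S" "\<And>x. x \<in> S \<Longrightarrow> (\<Sum>y\<in>S. Q x y * \<phi> y) = c * \<phi> x" "x \<in> S"
  shows "(\<Sum>y\<in>S. transition_function S Q t x y * \<phi> y) = exp (t * c) * \<phi> x"
proof -
  have s: "summable (\<lambda>k. t ^ k / fact k * matrix_power_on S Q k x y)" for y
    by (rule summable_transition_function[OF assms(1,3)])
  have "(\<Sum>y\<in>S. transition_function S Q t x y * \<phi> y)
      = (\<Sum>y\<in>S. \<Sum>k. t ^ k / fact k * matrix_power_on S Q k x y * \<phi> y)"
    unfolding transition_function_def by (simp only: suminf_mult2[OF s])
  also have "\<dots> = (\<Sum>k. \<Sum>y\<in>S. t ^ k / fact k * matrix_power_on S Q k x y * \<phi> y)"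
    by (rule suminf_sum[symmetric]) (rule summable_mult2[OF s])
  also have "\<dots> = (\<Sum>k. (t * c) ^ k /\<^sub>R fact k * \<phi> x)"
  proof (rule suminf_cong)
    fix k
    have "(\<Sum>y\<in>S. t ^ k / fact k * matrix_power_on S Q k x y * \<phi> y)
        = t ^ k / fact k * (\<Sum>y\<in>S. matrix_power_on S Q k x y * \<phi> y)"
      by (simp add: sum_distrib_left mult.assoc)
    also have "\<dots> = (t * c) ^ k /\<^sub>R fact k * \<phi> x"
      using matrix_power_on_eigenvector[OF assms] by (simp add: power_mult_distrib field_simps)
    finally show "(\<Sum>y\<in>S. t ^ k / fact k * matrix_power_on S Q k x y * \<phi> y)
        = (t * c) ^ k /\<^sub>R fact k * \<phi> x" .
  qed
  also have "\<dots> = exp (t * c) * \<phi> x"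
    by (simp only: exp_def suminf_mult2[OF summable_exp_generic])
  finally show ?thesis .
qed

section \<open>Fourier expansion in the eigenbasis\<close>

text \<open>
  The basis spans, and orthonormality forces the coordinates of a function to be its inner products
  with the basis.
\<close>

lemma fourier_expansion:
  assumes "spectral_decomposition S Q \<pi> lam \<psi>" "x \<in> S"
  shows "g x = (\<Sum>i<card S. fourier_coeff S \<pi> \<psi> g i * \<psi> i x)"
proof -
  obtain c where c: "\<And>x. x \<in> S \<Longrightarrow> g x = (\<Sum>i<card S. c i * \<psi> i x)"
    using assms(1) unfolding spectral_decomposition_def by blast
  have "fourier_coeff S \<pi> \<psi> g j = c j" if j: "j < card S" for j
  proof -
    have "fourier_coeff S \<pi> \<psi> g j
        = (\<Sum>w\<in>S. \<Sum>i<card S. c i * (\<pi> w * \<psi> i w * \<psi> j w))"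
      unfolding fourier_coeff_def stat_inner_def
      by (intro sum.cong) (simp_all add: c sum_distrib_left sum_distrib_right ac_simps)
    also have "\<dots> = (\<Sum>i<card S. c i * stat_inner S \<pi> (\<psi> i) (\<psi> j))"
      unfolding stat_inner_def by (subst sum.swap) (simp add: sum_distrib_left)
    also have "\<dots> = (\<Sum>i<card S. if i = j then c i else 0)"
      using assms(1) j unfolding spectral_decomposition_def by (intro sum.cong) auto
    finally show ?thesis using j by simp
  qed
  then show ?thesis using c[OF assms(2)] by simp
qed

lemma parseval:
  assumes "spectral_decomposition S Q \<pi> lam \<psi>"
  shows "stat_inner S \<pi> g h
    = (\<Sum>i<card S. fourier_coeff S \<pi> \<psi> g i * fourier_coeff S \<pi> \<psi> h i)"
proof -
  have "stat_inner S \<pi> g h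
      = (\<Sum>w\<in>S. \<pi> w * g w * (\<Sum>i<card S. fourier_coeff S \<pi> \<psi> h i * \<psi> i w))"
    unfolding stat_inner_def using fourier_expansion[OF assms, of _ h] by (intro sum.cong) auto
  also have "\<dots> = (\<Sum>i<card S. fourier_coeff S \<pi> \<psi> h i * stat_inner S \<pi> g (\<psi> i))"
    unfolding stat_inner_def sum_distrib_left by (subst sum.swap) (simp add: ac_simps)
  finally show ?thesis by (simp add: fourier_coeff_def mult.commute)
qed

text \<open>
  Since the transition operator only multiplies the coefficients of \<open>h\<close> by \<open>exp (- t \<lambda>\<^sub>i)\<close>,
  Parseval's identity acquires these weights when \<open>h\<close> is moved forward by time \<open>t\<close>.
\<close>

lemma transition_form_spectral:
  assumes "finite S" "spectral_decomposition S Q \<pi> lam \<psi>"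
  shows "(\<Sum>x\<in>S. \<Sum>y\<in>S. \<pi> x * transition_function S Q t x y * (g x * h y))
    = (\<Sum>i<card S. exp (- t * lam i) * fourier_coeff S \<pi> \<psi> g i * fourier_coeff S \<pi> \<psi> h i)"
proof -
  have eig: "(\<Sum>y\<in>S. Q x y * \<psi> i y) = - lam i * \<psi> i x" if "i < card S" "x \<in> S" for i x
    using assms(2) that unfolding spectral_decomposition_def by fastforce
  have "(\<Sum>y\<in>S. transition_function S Q t x y * h y)
      = (\<Sum>i<card S. exp (- t * lam i) * fourier_coeff S \<pi> \<psi> h i * \<psi> i x)" if x: "x \<in> S" for x
  proof -
    have "(\<Sum>y\<in>S. transition_function S Q t x y * h y)
        = (\<Sum>y\<in>S. \<Sum>i<card S.
            fourier_coeff S \<pi> \<psi> h i * (transition_function S Q t x y * \<psi> i y))"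
    proof (rule sum.cong)
      fix y assume "y \<in> S"
      then show "transition_function S Q t x y * h y = (\<Sum>i<card S.
            fourier_coeff S \<pi> \<psi> h i * (transition_function S Q t x y * \<psi> i y))"
        by (subst fourier_expansion[OF assms(2), of y h])
          (simp_all add: sum_distrib_left ac_simps)
    qed simp
    also have "\<dots> = (\<Sum>i<card S. fourier_coeff S \<pi> \<psi> h i *
        (\<Sum>y\<in>S. transition_function S Q t x y * \<psi> i y))"
      by (subst sum.swap) (simp add: sum_distrib_left)
    also have "\<dots> = (\<Sum>i<card S. exp (- t * lam i) * fourier_coeff S \<pi> \<psi> h i * \<psi> i x)"
      by (intro sum.cong)
        (simp_all add: transition_function_eigenvector[OF assms(1) eig x])
    finally show ?thesis .
  qed
  then have "stat_inner S \<pi> g (\<lambda>x. \<Sum>y\<in>S. transition_function S Q t x y * h y)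
      = (\<Sum>x\<in>S. \<Sum>i<card S.
          exp (- t * lam i) * fourier_coeff S \<pi> \<psi> h i * (\<pi> x * g x * \<psi> i x))"
    unfolding stat_inner_def by (simp add: sum_distrib_left ac_simps)
  also have "\<dots> = (\<Sum>i<card S.
      exp (- t * lam i) * fourier_coeff S \<pi> \<psi> h i * fourier_coeff S \<pi> \<psi> g i)"
    unfolding fourier_coeff_def stat_inner_def[of S \<pi> g]
    by (subst sum.swap) (simp add: sum_distrib_left)
  finally show ?thesis
    by (simp add: stat_inner_def sum_distrib_left ac_simps)
qed

lemma fourier_coeff_one:
  assumes "spectral_decomposition S Q \<pi> lam \<psi>" "i < card S"
  shows "fourier_coeff S \<pi> \<psi> (\<lambda>_. 1) i = (if i = 0 then 1 else 0)"
proof -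
  have "0 < card S" using assms(2) by simp
  have "fourier_coeff S \<pi> \<psi> (\<lambda>_. 1) i = stat_inner S \<pi> (\<psi> 0) (\<psi> i)"
    using assms(1) unfolding fourier_coeff_def stat_inner_def spectral_decomposition_def
    by (intro sum.cong) auto
  then show ?thesis
    using assms \<open>0 < card S\<close> unfolding spectral_decomposition_def by auto
qed

lemma spectral_decomposition_nonneg:
  assumes "spectral_decomposition S Q \<pi> lam \<psi>" "i < card S"
  shows "0 \<le> lam i"
  using assms unfolding spectral_decomposition_def by (metis le0)

text \<open>
  The square \<open>(g x - g y)\<^sup>2\<close> expands into three bilinear terms.  The two diagonal ones pair \<open>g\<^sup>2\<close> with
  the constant function 1, which is the eigenvector \<open>\<psi>\<^sub>0\<close> of eigenvalue 0: only the index 0 survives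
  in the spectral sum, with weight \<open>exp 0 = 1\<close>, so each of them equals \<open>\<langle>g, g\<rangle>\<close> whatever \<open>t\<close> is.
  Parseval turns \<open>\<langle>g, g\<rangle>\<close> into the sum of the squared coefficients.
\<close>

lemma dirichlet_form_spectral:
  assumes "finite S" "spectral_decomposition S Q \<pi> lam \<psi>" "0 < card S"
  shows "(\<Sum>x\<in>S. \<Sum>y\<in>S. \<pi> x * transition_function S Q t x y * (g x - g y)\<^sup>2)
    = 2 * (\<Sum>i<card S. (1 - exp (- t * lam i)) * (fourier_coeff S \<pi> \<psi> g i)\<^sup>2)"
proof -
  let ?P = "\<lambda>g h. \<Sum>x\<in>S. \<Sum>y\<in>S. \<pi> x * transition_function S Q t x y * (g x * h y)"
  let ?F = "fourier_coeff S \<pi> \<psi>"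
  let ?one = "\<lambda>_. 1 :: real"
  have lam0: "lam 0 = 0" using assms(2) unfolding spectral_decomposition_def by simp
  have F0: "?F (\<lambda>x. (g x)\<^sup>2) 0 = (\<Sum>i<card S. (?F g i)\<^sup>2)"
  proof -
    have "?F (\<lambda>x. (g x)\<^sup>2) 0 = stat_inner S \<pi> g g"
      using assms(2) unfolding fourier_coeff_def stat_inner_def spectral_decomposition_def
      by (intro sum.cong) (auto simp: power2_eq_square)
    then show ?thesis using parseval[OF assms(2), of g g] by (simp add: power2_eq_square)
  qed
  have l: "?P (\<lambda>x. (g x)\<^sup>2) ?one = (\<Sum>i<card S. (?F g i)\<^sup>2)"
  proof -
    have "?P (\<lambda>x. (g x)\<^sup>2) ?one = (\<Sum>i<card S. if i = 0 then ?F (\<lambda>x. (g x)\<^sup>2) 0 else 0)"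
      unfolding transition_form_spectral[OF assms(1,2)]
      by (intro sum.cong) (auto simp: fourier_coeff_one[OF assms(2)] lam0)
    then show ?thesis using assms(3) F0 by simp
  qed
  have r: "?P ?one (\<lambda>x. (g x)\<^sup>2) = (\<Sum>i<card S. (?F g i)\<^sup>2)"
  proof -
    have "?P ?one (\<lambda>x. (g x)\<^sup>2) = (\<Sum>i<card S. if i = 0 then ?F (\<lambda>x. (g x)\<^sup>2) 0 else 0)"
      unfolding transition_form_spectral[OF assms(1,2)]
      by (intro sum.cong) (auto simp: fourier_coeff_one[OF assms(2)] lam0)
    then show ?thesis using assms(3) F0 by simp
  qed
  have "(\<Sum>x\<in>S. \<Sum>y\<in>S. \<pi> x * transition_function S Q t x y * (g x - g y)\<^sup>2)
      = ?P (\<lambda>x. (g x)\<^sup>2) ?one + ?P ?one (\<lambda>x. (g x)\<^sup>2) - 2 * ?P g g"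
    unfolding sum_distrib_left sum.distrib[symmetric] sum_subtractf[symmetric]
    by (intro sum.cong) (simp_all add: power2_diff algebra_simps)
  also have "\<dots> = 2 * ((\<Sum>i<card S. (?F g i)\<^sup>2)
      - (\<Sum>i<card S. exp (- t * lam i) * ?F g i * ?F g i))"
    unfolding l r transition_form_spectral[OF assms(1,2)] by simp
  also have "\<dots> = 2 * (\<Sum>i<card S. (1 - exp (- t * lam i)) * (?F g i)\<^sup>2)"
    unfolding sum_subtractf[symmetric]
    by (intro arg_cong[of _ _ "(*) 2"] sum.cong) (simp_all add: algebra_simps power2_eq_square)
  finally show ?thesis .
qed

section \<open>The probability of disagreement\<close>

context finite_ctmc
begin

text \<open>
  The Markov property describes a conditional probability given a state of positive probability;
  at a null state both sides vanish.
\<close>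

lemma prob_two_times:
  assumes "0 < t" "x \<in> S" "y \<in> S"
  shows "\<P>(\<omega> in M. X 0 \<omega> = x \<and> X t \<omega> = y) = \<mu> x * transition_function S Q t x y"
proof -
  have [measurable]: "X 0 \<in> measurable M (count_space S)" "X t \<in> measurable M (count_space S)"
    using measurable_X assms(1) by auto
  show ?thesis
  proof (cases "\<mu> x = 0")
    case True
    have "\<P>(\<omega> in M. X 0 \<omega> = x \<and> X t \<omega> = y) \<le> \<P>(\<omega> in M. X 0 \<omega> = x)"
      by (intro finite_measure_mono) auto
    then show ?thesis using True initial[OF assms(2)] by (simp add: measure_le_0_iff)
  next
    case False
    then have pos: "0 < \<P>(\<omega> in M. X 0 \<omega> = x)"
      using initial[OF assms(2)] measure_nonneg[of M "{\<omega> \<in> space M. X 0 \<omega> = x}"]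
      by linarith
    \<comment> \<open>The Markov property at the two times \<open>0 < t\<close>: both sequences matter at the indices 0 and 1
        alone, and their continuation is arbitrary.\<close>
    have "\<P>(\<omega> in M. X t \<omega> = y \<bar> X 0 \<omega> = x) = transition_function S Q t x y"
      using markov[of "\<lambda>j. real j * t" 0 "\<lambda>j. if j = 0 then x else y"] pos assms by simp
    then show ?thesis
      using pos initial[OF assms(2)] by (simp add: cond_prob_def field_simps conj_commute)
  qed
qed

text \<open>
  For values in \<open>{0, 1}\<close> the indicator of \<open>f x \<noteq> f y\<close> is \<open>(f x - f y)\<^sup>2\<close>.  This is where Booleanness
  makes a probability into a quadratic form.
\<close>

lemma disagreement_eq_sum:
  assumes "0 < t" "f \<in> S \<rightarrow> {0, 1::real}"
  shows "\<P>(\<omega> in M. f (X 0 \<omega>) \<noteq> f (X t \<omega>))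
    = (\<Sum>x\<in>S. \<Sum>y\<in>S. \<mu> x * transition_function S Q t x y * (f x - f y)\<^sup>2)"
proof -
  have m[measurable]: "X 0 \<in> measurable M (count_space S)" "X t \<in> measurable M (count_space S)"
    using measurable_X assms(1) by auto
  define A where "A = {z \<in> S \<times> S. f (fst z) \<noteq> f (snd z)}"
  let ?E = "\<lambda>z. {\<omega> \<in> space M. X 0 \<omega> = fst z \<and> X t \<omega> = snd z}"
  have fin: "finite A" unfolding A_def using finite_states by auto
  have "{\<omega> \<in> space M. f (X 0 \<omega>) \<noteq> f (X t \<omega>)} = (\<Union>z\<in>A. ?E z)"
    using measurable_space[OF m(1)] measurable_space[OF m(2)] unfolding A_def by auto
  then have "\<P>(\<omega> in M. f (X 0 \<omega>) \<noteq> f (X t \<omega>)) = measure M (\<Union>z\<in>A. ?E z)"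
    by simp
  also have "\<dots> = (\<Sum>z\<in>A. measure M (?E z))"
  proof (rule finite_measure_finite_Union[OF fin])
    show "?E ` A \<subseteq> sets M" by auto
    show "disjoint_family_on ?E A" unfolding disjoint_family_on_def by auto
  qed
  also have "\<dots> = (\<Sum>z\<in>A. \<mu> (fst z) * transition_function S Q t (fst z) (snd z))"
    using prob_two_times[OF assms(1)] unfolding A_def by (intro sum.cong) auto
  also have "\<dots> = (\<Sum>z\<in>S \<times> S.
      \<mu> (fst z) * transition_function S Q t (fst z) (snd z) * (f (fst z) - f (snd z))\<^sup>2)"
  proof (rule sum.mono_neutral_cong_left)
    fix z assume "z \<in> A"
    then have "f (fst z) \<noteq> f (snd z)" "f (fst z) \<in> {0, 1}" "f (snd z) \<in> {0, 1}"
      using assms(2) unfolding A_def by auto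
    then have "(f (fst z) - f (snd z))\<^sup>2 = 1" by auto
    then show "\<mu> (fst z) * transition_function S Q t (fst z) (snd z)
        = \<mu> (fst z) * transition_function S Q t (fst z) (snd z) * (f (fst z) - f (snd z))\<^sup>2"
      by simp
  qed (use finite_states in \<open>auto simp: A_def\<close>)
  finally show ?thesis by (simp add: sum.cartesian_product case_prod_beta)
qed

lemma disagreement_spectral:
  assumes "spectral_decomposition S Q \<mu> lam \<psi>" "0 < card S" "0 < t" "f \<in> S \<rightarrow> {0, 1::real}"
  shows "\<P>(\<omega> in M. f (X 0 \<omega>) \<noteq> f (X t \<omega>))
    = 2 * (\<Sum>i<card S. (1 - exp (- t * lam i)) * (fourier_coeff S \<mu> \<psi> f i)\<^sup>2)"
  using disagreement_eq_sum[OF assms(3,4)] dirichlet_form_spectral[OF finite_states assms(1,2)]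
  by simp

end

section \<open>Comparison with the spectral tail\<close>

lemma sum_fourier_coeff_le_1:
  assumes "spectral_decomposition S Q \<pi> lam \<psi>" "stationary_distribution S Q \<pi>"
    and "f \<in> S \<rightarrow> {0, 1}"
  shows "(\<Sum>i<card S. (fourier_coeff S \<pi> \<psi> f i)\<^sup>2) \<le> 1"
proof -
  have "(\<Sum>i<card S. (fourier_coeff S \<pi> \<psi> f i)\<^sup>2) = (\<Sum>w\<in>S. \<pi> w * f w * f w)"
    using parseval[OF assms(1), of f f] by (simp add: stat_inner_def power2_eq_square)
  also have "\<dots> \<le> (\<Sum>w\<in>S. \<pi> w)"
  proof (rule sum_mono)
    fix w assume "w \<in> S"
    then have "f w = 0 \<or> f w = 1" "0 \<le> \<pi> w"
      using assms(2,3) unfolding stationary_distribution_def by auto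
    then show "\<pi> w * f w * f w \<le> \<pi> w" by auto
  qed
  finally show ?thesis using assms(2) unfolding stationary_distribution_def by simp
qed

definition spectral_tail ::
    "'s set \<Rightarrow> ('s \<Rightarrow> real) \<Rightarrow> (nat \<Rightarrow> real) \<Rightarrow> (nat \<Rightarrow> 's \<Rightarrow> real) \<Rightarrow> ('s \<Rightarrow> real) \<Rightarrow> nat \<Rightarrow> real" where
  "spectral_tail S \<pi> lam \<psi> f k =
     (\<Sum>i | i < card S \<and> real k * lam 1 \<le> lam i. (fourier_coeff S \<pi> \<psi> f i)\<^sup>2)"

lemma spectral_tail_le_1:
  assumes "spectral_decomposition S Q \<pi> lam \<psi>" "stationary_distribution S Q \<pi>"
    and "f \<in> S \<rightarrow> {0, 1}"
  shows "spectral_tail S \<pi> lam \<psi> f k \<le> 1"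
proof -
  have "spectral_tail S \<pi> lam \<psi> f k \<le> (\<Sum>i<card S. (fourier_coeff S \<pi> \<psi> f i)\<^sup>2)"
    unfolding spectral_tail_def by (intro sum_mono2) auto
  also have "\<dots> \<le> 1" by (rule sum_fourier_coeff_le_1[OF assms])
  finally show ?thesis .
qed

text \<open>
  Above level \<open>k\<close> each weight is at least \<open>1 - exp (-1)\<close>, which is at least a half; the factor 2 of
  the spectral formula makes up for that half.  The remaining terms are nonnegative and are dropped.
\<close>

lemma (in finite_ctmc) tail_le_disagreement:
  assumes sd: "spectral_decomposition S Q \<mu> lam \<psi>" and "0 < card S" "0 < \<alpha>"
    and f: "f \<in> S \<rightarrow> {0, 1::real}" and k: "1 \<le> \<alpha> * real k"
  shows "spectral_tail S \<mu> lam \<psi> f k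
    \<le> \<P>(\<omega> in M. f (X 0 \<omega>) \<noteq> f (X (\<alpha> * relaxation_time lam) \<omega>))"
proof -
  let ?t = "\<alpha> * relaxation_time lam"
  let ?F = "fourier_coeff S \<mu> \<psi> f"
  have l1: "0 < lam 1" using sd unfolding spectral_decomposition_def by simp
  have t: "0 < ?t" using l1 assms(3) by (simp add: relaxation_time_def)
  have "(?F i)\<^sup>2 \<le> 2 * ((1 - exp (- ?t * lam i)) * (?F i)\<^sup>2)"
    if "real k * lam 1 \<le> lam i" for i
  proof -
    have "1 \<le> \<alpha> * real k" by (rule k)
    also have "\<dots> = ?t * (real k * lam 1)" using l1 by (simp add: relaxation_time_def)
    also have "\<dots> \<le> ?t * lam i" using that t by (intro mult_left_mono) auto
    finally have "exp (- ?t * lam i) \<le> exp (-1)" by simp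
    also have "exp (-1 :: real) \<le> 1 / 2"
      using exp_ge_add_one_self[of 1] by (simp add: exp_minus field_simps)
    finally have "1 * (?F i)\<^sup>2 \<le> (2 * (1 - exp (- ?t * lam i))) * (?F i)\<^sup>2"
      by (intro mult_right_mono) auto
    then show ?thesis by (simp only: mult_1_left mult.assoc)
  qed
  then have "spectral_tail S \<mu> lam \<psi> f k
      \<le> (\<Sum>i | i < card S \<and> real k * lam 1 \<le> lam i. 2 * ((1 - exp (- ?t * lam i)) * (?F i)\<^sup>2))"
    unfolding spectral_tail_def by (intro sum_mono) blast
  also have "\<dots> \<le> (\<Sum>i<card S. 2 * ((1 - exp (- ?t * lam i)) * (?F i)\<^sup>2))"
    using spectral_decomposition_nonneg[OF sd] t by (intro sum_mono2) auto
  also have "\<dots> = \<P>(\<omega> in M. f (X 0 \<omega>) \<noteq> f (X ?t \<omega>))"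
    unfolding disagreement_spectral[OF sd assms(2) t f] by (simp add: sum_distrib_left)
  finally show ?thesis .
qed

text \<open>
  Above level \<open>k\<close> the weights are bounded by 1; below it \<open>1 - exp (- u) \<le> u\<close> bounds them by \<open>\<alpha> k\<close>,
  and the total mass is at most 1.
\<close>

lemma (in finite_ctmc) disagreement_le_tail:
  assumes sd: "spectral_decomposition S Q \<mu> lam \<psi>" and st: "stationary_distribution S Q \<mu>"
    and "0 < card S" "0 < \<alpha>" and f: "f \<in> S \<rightarrow> {0, 1::real}"
  shows "\<P>(\<omega> in M. f (X 0 \<omega>) \<noteq> f (X (\<alpha> * relaxation_time lam) \<omega>))
    \<le> 2 * \<alpha> * real k + 2 * spectral_tail S \<mu> lam \<psi> f k"
proof -
  let ?t = "\<alpha> * relaxation_time lam"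
  let ?F = "fourier_coeff S \<mu> \<psi> f"
  let ?H = "{i. i < card S \<and> real k * lam 1 \<le> lam i}"
  have l1: "0 < lam 1" using sd unfolding spectral_decomposition_def by simp
  have t: "0 < ?t" using l1 assms(4) by (simp add: relaxation_time_def)
  have "(1 - exp (- ?t * lam i)) * (?F i)\<^sup>2
      \<le> \<alpha> * real k * (?F i)\<^sup>2 + (if i \<in> ?H then (?F i)\<^sup>2 else 0)" if "i < card S" for i
  proof (cases "i \<in> ?H")
    case True
    have "(1 - exp (- ?t * lam i)) * (?F i)\<^sup>2 \<le> 1 * (?F i)\<^sup>2"
      by (intro mult_right_mono) auto
    moreover have "0 \<le> \<alpha> * real k * (?F i)\<^sup>2" using assms(4) by simp
    ultimately show ?thesis using True by simp
  next
    case False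
    have "1 - exp (- ?t * lam i) \<le> ?t * lam i"
      using exp_ge_add_one_self[of "- ?t * lam i"] by simp
    also have "\<dots> \<le> ?t * (real k * lam 1)"
      using False that t by (intro mult_left_mono) auto
    also have "\<dots> = \<alpha> * real k" using l1 by (simp add: relaxation_time_def)
    finally have "(1 - exp (- ?t * lam i)) * (?F i)\<^sup>2 \<le> \<alpha> * real k * (?F i)\<^sup>2"
      by (intro mult_right_mono) auto
    then show ?thesis using False by auto
  qed
  then have "(\<Sum>i<card S. (1 - exp (- ?t * lam i)) * (?F i)\<^sup>2)
      \<le> (\<Sum>i<card S. \<alpha> * real k * (?F i)\<^sup>2 + (if i \<in> ?H then (?F i)\<^sup>2 else 0))"
    by (intro sum_mono) blast
  also have "\<dots> = \<alpha> * real k * (\<Sum>i<card S. (?F i)\<^sup>2) + spectral_tail S \<mu> lam \<psi> f k"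
    unfolding spectral_tail_def sum.distrib sum_distrib_left
    by (simp add: sum.inter_filter[symmetric])
  also have "\<dots> \<le> \<alpha> * real k * 1 + spectral_tail S \<mu> lam \<psi> f k"
    using sum_fourier_coeff_le_1[OF sd st f] assms(4)
    by (intro add_right_mono mult_left_mono) auto
  finally show ?thesis
    unfolding disagreement_spectral[OF sd assms(3) t f] by simp
qed

section \<open>Noise stability as spectral concentration\<close>

theorem proposition1p6:
  fixes M :: "nat \<Rightarrow> 'w measure"
    and X :: "nat \<Rightarrow> real \<Rightarrow> 'w \<Rightarrow> 's"
    and S :: "nat \<Rightarrow> 's set"
    and Q :: "nat \<Rightarrow> 's \<Rightarrow> 's \<Rightarrow> real"
    and \<pi> :: "nat \<Rightarrow> 's \<Rightarrow> real"
    and lam :: "nat \<Rightarrow> nat \<Rightarrow> real"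
    and \<psi> :: "nat \<Rightarrow> nat \<Rightarrow> 's \<Rightarrow> real"
    and f :: "nat \<Rightarrow> 's \<Rightarrow> real"
  assumes chain: "\<And>n. 1 \<le> n \<Longrightarrow> finite_ctmc (M n) (X n) (S n) (Q n) (\<pi> n)"
    and card_states: "\<And>n. 1 \<le> n \<Longrightarrow> 2 \<le> card (S n)"
    and stationary: "\<And>n. 1 \<le> n \<Longrightarrow> stationary_distribution (S n) (Q n) (\<pi> n)"
    and irreducible: "\<And>n. 1 \<le> n \<Longrightarrow> irreducible_on (S n) (Q n)"
    and reversible: "\<And>n. 1 \<le> n \<Longrightarrow> reversible_on (S n) (Q n) (\<pi> n)"
    and spectral: "\<And>n. 1 \<le> n \<Longrightarrow> spectral_decomposition (S n) (Q n) (\<pi> n) (lam n) (\<psi> n)"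
    and boolean: "\<And>n. 1 \<le> n \<Longrightarrow> f n \<in> S n \<rightarrow> {0, 1}"
  shows "noise_stable M X (\<lambda>n. relaxation_time (lam n)) f \<longleftrightarrow>
    (\<forall>\<delta>>0. \<exists>k::nat.
       (SUP n\<in>{1..}. \<Sum>i | i < card (S n) \<and> real k * lam n 1 \<le> lam n i.
          (fourier_coeff (S n) (\<pi> n) (\<psi> n) (f n) i)\<^sup>2) < \<delta>)"
proof -
  define D where "D \<alpha> n =
    \<P>(\<omega> in M n. f n (X n 0 \<omega>) \<noteq> f n (X n (\<alpha> * relaxation_time (lam n)) \<omega>))" for \<alpha> n
  define T where "T k n = spectral_tail (S n) (\<pi> n) (lam n) (\<psi> n) (f n) k" for k n
  have prob: "prob_space (M n)" if "1 \<le> n" for n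
    using chain[OF that] by (simp add: finite_ctmc_def)
  have card: "0 < card (S n)" if "1 \<le> n" for n
    using card_states[OF that] by simp
  have T_le_D: "T k n \<le> D \<alpha> n" if "1 \<le> n" "0 < \<alpha>" "1 \<le> \<alpha> * real k" for k n \<alpha>
    unfolding T_def D_def
    by (rule finite_ctmc.tail_le_disagreement[OF chain[OF that(1)] spectral[OF that(1)]
          card[OF that(1)] that(2) boolean[OF that(1)] that(3)])
  have D_le_T: "D \<alpha> n \<le> 2 * \<alpha> * real k + 2 * T k n" if "1 \<le> n" "0 < \<alpha>" for k n \<alpha>
    unfolding T_def D_def
    by (rule finite_ctmc.disagreement_le_tail[OF chain[OF that(1)] spectral[OF that(1)]
          stationary[OF that(1)] card[OF that(1)] that(2) boolean[OF that(1)]])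
  have bdd_D: "bdd_above (D \<alpha> ` {1..})" for \<alpha>
    unfolding D_def using prob_space.prob_le_1[OF prob] by (intro bdd_aboveI2[of _ _ 1]) auto
  have bdd_T: "bdd_above (T k ` {1..})" for k
    unfolding T_def using spectral_tail_le_1[OF spectral stationary boolean]
    by (intro bdd_aboveI2[of _ _ 1]) auto
  have D_nonneg: "0 \<le> (SUP n\<in>{1..}. D \<alpha> n)" for \<alpha>
    using cSUP_upper2[OF bdd_D, of 1 0] by (simp add: D_def)
  have "((\<lambda>\<alpha>. SUP n\<in>{1..}. D \<alpha> n) \<longlongrightarrow> 0) (at_right 0) \<longleftrightarrow>
      (\<forall>\<delta>>0. \<exists>k. (SUP n\<in>{1..}. T k n) < \<delta>)"
  proof
    assume lim: "((\<lambda>\<alpha>. SUP n\<in>{1..}. D \<alpha> n) \<longlongrightarrow> 0) (at_right 0)"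
    show "\<forall>\<delta>>0. \<exists>k. (SUP n\<in>{1..}. T k n) < \<delta>"
    proof (intro allI impI)
      fix \<delta> :: real assume "0 < \<delta>"
      with lim have "\<forall>\<^sub>F \<alpha> in at_right 0. (SUP n\<in>{1..}. D \<alpha> n) < \<delta>"
        by (rule order_tendstoD)
      then have "\<forall>\<^sub>F \<alpha> in at_right 0. 0 < \<alpha> \<and> (SUP n\<in>{1..}. D \<alpha> n) < \<delta>"
        using eventually_at_right_less[of 0] by eventually_elim auto
      then obtain \<alpha> where \<alpha>: "0 < \<alpha>" "(SUP n\<in>{1..}. D \<alpha> n) < \<delta>"
        using eventually_happens'[OF trivial_limit_at_right_real] by blast
      obtain k :: nat where "1 / \<alpha> \<le> real k" using real_arch_simple by blast
      then have k: "1 \<le> \<alpha> * real k" using \<alpha>(1) by (simp add: field_simps)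
      have "(SUP n\<in>{1..}. T k n) \<le> (SUP n\<in>{1..}. D \<alpha> n)"
        using T_le_D[OF _ \<alpha>(1) k] bdd_D by (intro cSUP_mono) auto
      then have "(SUP n\<in>{1..}. T k n) < \<delta>" using \<alpha>(2) by (rule le_less_trans)
      then show "\<exists>k. (SUP n\<in>{1..}. T k n) < \<delta>" ..
    qed
  next
    assume conc: "\<forall>\<delta>>0. \<exists>k. (SUP n\<in>{1..}. T k n) < \<delta>"
    show "((\<lambda>\<alpha>. SUP n\<in>{1..}. D \<alpha> n) \<longlongrightarrow> 0) (at_right 0)"
    proof (rule order_tendstoI)
      fix a :: real assume "a < 0"
      then show "\<forall>\<^sub>F \<alpha> in at_right 0. a < (SUP n\<in>{1..}. D \<alpha> n)"
        using D_nonneg by (intro always_eventually) (auto intro: less_le_trans)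
    next
      fix \<epsilon> :: real assume \<epsilon>: "0 < \<epsilon>"
      then obtain k where k: "(SUP n\<in>{1..}. T k n) < \<epsilon> / 4"
        using conc[rule_format, of "\<epsilon> / 4"] by auto
      \<comment> \<open>The denominator has \<open>k + 1\<close> rather than \<open>k\<close>, as the level \<open>k\<close> may be 0.\<close>
      have "\<forall>\<^sub>F \<alpha> in at_right 0. 0 < \<alpha> \<and> \<alpha> < \<epsilon> / (4 * (real k + 1))"
        using \<epsilon> unfolding eventually_at_right_field
        by (intro exI[of _ "\<epsilon> / (4 * (real k + 1))"]) auto
      then show "\<forall>\<^sub>F \<alpha> in at_right 0. (SUP n\<in>{1..}. D \<alpha> n) < \<epsilon>"
      proof eventually_elim
        case (elim \<alpha>)
        have "(SUP n\<in>{1..}. D \<alpha> n) \<le> 2 * \<alpha> * real k + 2 * (SUP n\<in>{1..}. T k n)"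
        proof (rule cSUP_least)
          fix n :: nat assume n: "n \<in> {1..}"
          have "D \<alpha> n \<le> 2 * \<alpha> * real k + 2 * T k n" using D_le_T n elim by auto
          also have "T k n \<le> (SUP n\<in>{1..}. T k n)" by (rule cSUP_upper[OF n bdd_T])
          finally show "D \<alpha> n \<le> 2 * \<alpha> * real k + 2 * (SUP n\<in>{1..}. T k n)" by simp
        qed simp
        moreover have "4 * \<alpha> * real k < \<epsilon>"
        proof -
          have "\<alpha> * (4 * (real k + 1)) < \<epsilon>" using elim by (simp add: pos_less_divide_eq)
          then show ?thesis using elim by (simp add: algebra_simps)
        qed
        ultimately show ?case using k by linarith
      qed
    qed
  qed
  then show ?thesis
    unfolding noise_stable_def D_def T_def spectral_tail_def .
qed

end
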